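(* Let $x,y$ be positive integers with $xy\geq 4$, and let $d=x^2y$. Suppose that for each $D\in\{d,\,xd\}$ there exists a reduced fraction $\frac{b}{D}=[0,a_1,a_2,\dots,a_n]$ with denominator $D$ such that all partial quotients satisfy $a_j\leq xy-1$ and the first and last partial quotients satisfy $2\leq a_1\leq xy-2$ and $2\leq a_n\leq xy-2$ (the fraction, and the length $n$, may depend on $D$). Then for every integer $k\geq 1$ the integer $d^k$ is $A$-Zaremba with $A=xy-1$.
   Context: For integers $a_1,\dots,a_n\geq 1$, $[0,a_1,a_2,\dots,a_n]$ denotes the simple continued fraction $$\cfrac{1}{a_1+\cfrac{1}{a_2+\cfrac{1}{\ddots+\cfrac{1}{a_n}}}},$$ and the $a_j$ are its partial quotients. The finite continued fraction expansion of a rational number is made unique by requiring $a_n>1$. For a positive integer $A$, an integer $D\geq 2$ is called $A$-Zaremba if there is a reduced fraction $\frac{b}{D}=[0,a_1,a_2,\dots,a_n]$ (that is, $\gcd(b,D)=1$) with $\max_j a_j\leq A$. *)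

theory Defs
  imports Complex_Main
begin

text \<open>
  \<open>contfrac [a\<^sub>1, \<dots>, a\<^sub>n]\<close> is \<open>[0, a\<^sub>1, \<dots>, a\<^sub>n]\<close>: the integer part 0 is implicit. The empty list, with
  value 0, only serves to end the recursion.
\<close>

fun contfrac :: "nat list \<Rightarrow> rat" where
  "contfrac [] = 0"
| "contfrac (a # as) = 1 / (of_nat a + contfrac as)"

text \<open>
  The condition on the last partial quotient is the normalisation which makes the expansion unique.
\<close>

definition is_contfrac_expansion :: "rat \<Rightarrow> nat list \<Rightarrow> bool" where
  "is_contfrac_expansion q as \<longleftrightarrow>
     as \<noteq> [] \<and> (\<forall>a\<in>set as. 1 \<le> a) \<and> 1 < last as \<and> q = contfrac as"

definition zaremba :: "nat \<Rightarrow> nat \<Rightarrow> bool" where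
  "zaremba A D \<longleftrightarrow> 2 \<le> D \<and>
     (\<exists>b as. coprime b D \<and> is_contfrac_expansion (of_nat b / of_nat D) as \<and> Max (set as) \<le> A)"

end

theory Submission
  imports Defs
begin

text \<open>
  The denominator of \<open>[0, a\<^sub>1, \<dots>, a\<^sub>n]\<close> is the continuant \<open>K(a\<^sub>1, \<dots>, a\<^sub>n)\<close>, and the numerator
  \<open>K(a\<^sub>2, \<dots>, a\<^sub>n)\<close> is automatically coprime to it. So only denominators have to be produced, and
  the statement is about which integers are continuants of lists with small entries.

  The tool is the folding lemma \<open>continuant_fold\<close>: from a list with continuant \<open>D\<close> and any
  \<open>z \<ge> 1\<close>, the nearly palindromic list
  \<open>a\<^sub>1, \<dots>, a\<^sub>n, z - 1, 1, a\<^sub>n - 1, a\<^sub>n\<^sub>-\<^sub>1, \<dots>, a\<^sub>1\<close>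
  has continuant \<open>z D^2\<close>. For \<open>z = 1\<close> the forbidden entry \<open>0\<close> is removed by merging its two
  neighbours into their sum, which turns the middle into \<open>a\<^sub>n + 1, a\<^sub>n - 1\<close>; so \<open>2 \<le> a\<^sub>n \<le> xy - 2\<close>
  keeps all entries between \<open>1\<close> and \<open>xy - 1\<close>. The first
  and the last entry of the new list are both \<open>a\<^sub>1\<close>, so the conditions on the end entries
  survive and folding can be repeated with every \<open>z \<le> xy\<close> (lemma \<open>fold_step\<close>).

  The two families \<open>d^k\<close> and \<open>x d^k\<close> are then obtained together from those with a smaller
  exponent, since \<open>d = x^2 y\<close> gives
  \<^item> \<open>d^(2j) = 1 \<cdot> (d^j)^2\<close> and \<open>x d^(2j) = x (d^j)^2\<close>,
  \<^item> \<open>d^(2j+1) = y (x d^j)^2\<close> and \<open>x d^(2j+1) = xy (x d^j)^2\<close>,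

  and all four multipliers \<open>1, x, y, xy\<close> lie between \<open>1\<close> and \<open>xy\<close>.
\<close>

section \<open>Continuants and folding\<close>

fun continuant :: "nat list \<Rightarrow> nat" where
  "continuant [] = 1"
| "continuant [a] = a"
| "continuant (a # b # as) = a * continuant (b # as) + continuant as"

lemma continuant_snoc:
  "continuant (as @ [b, a]) = a * continuant (as @ [b]) + continuant as"
  by (induction as rule: continuant.induct) (auto simp: algebra_simps)

lemma continuant_rev: "continuant (rev as) = continuant as"
  by (induction as rule: continuant.induct) (auto simp: continuant_snoc)

text \<open>
  Prepending a fixed list acts linearly on the pair of continuants of a list and of its tail: this
  is the first row of the product of the matrices \<open>(a 1; 1 0)\<close>, with \<open>p = K(w)\<close> and \<open>q\<close> the
  continuant of \<open>w\<close> without its last entry.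
\<close>

lemma continuant_append_linear:
  "\<exists>p q. \<forall>c v. continuant (w @ c # v) = p * continuant (c # v) + q * continuant v"
proof (induction w rule: continuant.induct)
  case 1
  show ?case by (intro exI[of _ 1] exI[of _ 0]) simp
next
  case (2 a)
  show ?case by (intro exI[of _ a] exI[of _ 1]) simp
next
  case (3 a b as)
  obtain p q where 1: "\<And>c v. continuant ((b # as) @ c # v) = p * continuant (c # v) + q * continuant v"
    using 3(1) by blast
  obtain p' q' where 2: "\<And>c v. continuant (as @ c # v) = p' * continuant (c # v) + q' * continuant v"
    using 3(2) by blast
  show ?case
    using 1 2
    by (intro exI[of _ "a * p + p'"] exI[of _ "a * q + q'"]) (simp add: algebra_simps)
qed

text \<open>
  Linearity is applied once from the left and, after reversing, once from the right. The continuant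
  thus becomes a quadratic form in \<open>p, q\<close> whose coefficients depend only on the middle block, and
  the middle block is made so that the form is \<open>(z + 1) ((a + 1) p + q)^2\<close>.
\<close>

lemma continuant_fold:
  "continuant (w @ [Suc a, z, 1, a] @ rev w) = Suc z * (continuant (w @ [Suc a]))\<^sup>2"
proof -
  obtain p q where pq:
    "\<And>c v. continuant (w @ c # v) = p * continuant (c # v) + q * continuant v"
    using continuant_append_linear by blast
  have "continuant (Suc a # z # 1 # a # rev w) = continuant (w @ [a, 1, z, Suc a])"
    using continuant_rev[of "w @ [a, 1, z, Suc a]"] by simp
  moreover have "continuant (z # 1 # a # rev w) = continuant (w @ [a, 1, z])"
    using continuant_rev[of "w @ [a, 1, z]"] by simp
  ultimately show ?thesis
    by (simp only: append_Cons append_Nil pq) (simp add: algebra_simps power2_eq_square)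
qed

text \<open>
  This is \<open>z = 0\<close> in the folding lemma, with the entry \<open>0\<close> and its neighbours
  \<open>Suc a\<close> and \<open>1\<close> replaced by the sum \<open>Suc (Suc a)\<close>, which does not change a continuant.
\<close>

lemma continuant_fold_square:
  "continuant (w @ [Suc (Suc a), a] @ rev w) = (continuant (w @ [Suc a]))\<^sup>2"
proof -
  obtain p q where pq:
    "\<And>c v. continuant (w @ c # v) = p * continuant (c # v) + q * continuant v"
    using continuant_append_linear by blast
  have "continuant (Suc (Suc a) # a # rev w) = continuant (w @ [a, Suc (Suc a)])"
    using continuant_rev[of "w @ [a, Suc (Suc a)]"] by simp
  moreover have "continuant (a # rev w) = continuant (w @ [a])"
    using continuant_rev[of "w @ [a]"] by simp
  ultimately show ?thesis
    by (simp only: append_Cons append_Nil pq) (simp add: algebra_simps power2_eq_square)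
qed

section \<open>Continuants as denominators of continued fractions\<close>

lemma continuant_pos: "\<forall>a\<in>set as. 1 \<le> a \<Longrightarrow> 0 < continuant as"
  by (induction as rule: continuant.induct) auto

lemma coprime_continuant_tl:
  "as \<noteq> [] \<Longrightarrow> coprime (continuant (tl as)) (continuant as)"
proof (induction as rule: continuant.induct)
  case (3 a b as)
  then have "coprime (continuant as) (continuant (b # as))" by simp
  then show ?case
    by (simp add: coprime_iff_gcd_eq_1 gcd.commute[of "continuant (b # as)"] gcd_add_mult
        del: One_nat_def)
qed auto

lemma contfrac_eq_continuants:
  "\<lbrakk>as \<noteq> []; \<forall>a\<in>set as. 1 \<le> a\<rbrakk> \<Longrightarrow>
     contfrac as = of_nat (continuant (tl as)) / of_nat (continuant as)"
proof (induction as rule: continuant.induct)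
  case (3 a b as)
  have "continuant (b # as) > 0" using 3(4) by (intro continuant_pos) auto
  then have nz: "(of_nat (continuant (b # as)) :: rat) \<noteq> 0" by simp
  have IH: "contfrac (b # as) = of_nat (continuant as) / of_nat (continuant (b # as))"
    using 3 by simp
  have "contfrac (a # b # as) = 1 / (of_nat a + contfrac (b # as))"
    by (rule contfrac.simps(2))
  also have "\<dots> = of_nat (continuant (b # as)) /
      (of_nat a * of_nat (continuant (b # as)) + of_nat (continuant as))"
    unfolding IH add_divide_eq_iff[OF nz] divide_divide_eq_right by simp
  finally show ?case by (simp only: continuant.simps list.sel of_nat_add of_nat_mult)
qed auto

lemma expansion_denominator:
  assumes "is_contfrac_expansion (of_nat b / of_nat D) as" and "coprime b D" and "0 < D"
  shows "continuant as = D"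
proof -
  have as: "as \<noteq> []" "\<forall>a\<in>set as. 1 \<le> a"
    and eq: "(of_nat b / of_nat D :: rat) = contfrac as"
    using assms(1) by (auto simp: is_contfrac_expansion_def)
  have pos: "continuant as > 0" using as by (intro continuant_pos)
  have "(of_nat (b * continuant as) :: rat) = of_nat (continuant (tl as) * D)"
    using eq pos assms(3) contfrac_eq_continuants[OF as] by (simp add: field_simps)
  then have cross: "b * continuant as = continuant (tl as) * D"
    by (simp only: of_nat_eq_iff)
  have "D dvd b * continuant as" unfolding cross by simp
  then have 1: "D dvd continuant as"
    using assms(2) by (simp add: coprime_dvd_mult_right_iff coprime_commute)
  have "continuant as dvd continuant (tl as) * D" unfolding cross[symmetric] by simp
  then have 2: "continuant as dvd D"
    using coprime_continuant_tl[OF as(1)]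
    by (simp add: coprime_dvd_mult_right_iff coprime_commute)
  show ?thesis using 1 2 by (simp add: dvd_antisym)
qed

section \<open>Powers by repeated folding\<close>

text \<open>
  The invariant that folding preserves. Length at least \<open>2\<close> is part of it because folding a
  one-entry list \<open>[a]\<close> would end in \<open>a - 1\<close>, which may be \<open>1\<close>.
\<close>

definition foldable :: "nat \<Rightarrow> nat \<Rightarrow> bool" where
  "foldable m D \<longleftrightarrow> (\<exists>as. 2 \<le> length as \<and> set as \<subseteq> {1..m - 1} \<and>
     hd as \<in> {2..m - 2} \<and> last as \<in> {2..m - 2} \<and> continuant as = D)"

lemma fold_step:
  assumes "foldable m D" and "1 \<le> z" and "z \<le> m"
  shows "foldable m (z * D\<^sup>2)"
proof -
  obtain as where as: "2 \<le> length as" "set as \<subseteq> {1..m - 1}" "hd as \<in> {2..m - 2}"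
    "last as \<in> {2..m - 2}" "continuant as = D"
    using assms(1) unfolding foldable_def by blast
  define w where "w = butlast as"
  define a where "a = last as - 1"
  have split: "as = w @ [Suc a]" using as(1,4) by (cases as rule: rev_cases) (auto simp: w_def a_def)
  have w: "w \<noteq> []" using as(1) split by auto
  have ends: "hd w \<in> {2..m - 2}" using as(3) w split by simp
  have ws: "set w \<subseteq> {1..m - 1}" using as(2) split by auto
  have a: "1 \<le> a" "Suc (Suc a) \<le> m - 1" using as(4) split by auto
  define bs where "bs = (if z = 1 then w @ [Suc (Suc a), a] @ rev w
                         else w @ [Suc a, z - 1, 1, a] @ rev w)"
  have "continuant bs = z * D\<^sup>2"
    using assms(2) as(5) continuant_fold[of w a "z - 1"] continuant_fold_square[of w a]
    by (auto simp: bs_def split)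
  moreover have "set bs \<subseteq> {1..m - 1}"
    using ws a assms(2,3) by (auto simp: bs_def)
  moreover have "2 \<le> length bs" by (simp add: bs_def)
  moreover have "hd bs = hd w" "last bs = hd w"
    using w by (auto simp: bs_def last_rev)
  ultimately show ?thesis unfolding foldable_def using ends by metis
qed

lemma foldable_imp_zaremba:
  assumes "foldable m D" and "2 \<le> D"
  shows "zaremba (m - 1) D"
proof -
  obtain as where as: "2 \<le> length as" "set as \<subseteq> {1..m - 1}" "last as \<in> {2..m - 2}"
    "continuant as = D"
    using assms(1) unfolding foldable_def by blast
  have ne: "as \<noteq> []" and ge: "\<forall>a\<in>set as. 1 \<le> a" using as(1,2) by auto
  have "is_contfrac_expansion (of_nat (continuant (tl as)) / of_nat D) as"
    using ne ge as(3,4) contfrac_eq_continuants[OF ne ge]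
    by (simp add: is_contfrac_expansion_def)
  moreover have "coprime (continuant (tl as)) D"
    using coprime_continuant_tl[OF ne] as(4) by simp
  moreover have "Max (set as) \<le> m - 1" using ne as(2) by auto
  ultimately show ?thesis using assms(2) unfolding zaremba_def by blast
qed

lemma foldable_powers:
  fixes x y d :: nat
  assumes "1 \<le> x" and "1 \<le> y" and "d = x\<^sup>2 * y"
    and "foldable (x * y) d" and "foldable (x * y) (x * d)"
    and "1 \<le> k"
  shows "foldable (x * y) (d ^ k) \<and> foldable (x * y) (x * d ^ k)"
  using \<open>1 \<le> k\<close>
proof (induction k rule: less_induct)
  case (less k)
  define j where "j = k div 2"
  have mult: "1 \<le> x * y" "x \<le> x * y" "y \<le> x * y" using assms(1,2) by auto
  show ?case
  proof (cases "k = 1")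
    case True
    then show ?thesis using assms(4,5) by simp
  next
    case False
    then have "j < k" "1 \<le> j" using less.prems by (auto simp: j_def)
    then have dj: "foldable (x * y) (d ^ j)" and xdj: "foldable (x * y) (x * d ^ j)"
      using less.IH by auto
    consider "k = j + j" | "k = Suc (j + j)" unfolding j_def by linarith
    then show ?thesis
    proof cases
      case 1
      have "d ^ k = 1 * (d ^ j)\<^sup>2" "x * d ^ k = x * (d ^ j)\<^sup>2"
        by (simp_all add: 1 power_add power2_eq_square)
      then show ?thesis
        using fold_step[OF dj, of 1] fold_step[OF dj, of x] mult assms(1) by simp
    next
      case 2
      have "d ^ k = y * (x * d ^ j)\<^sup>2" "x * d ^ k = (x * y) * (x * d ^ j)\<^sup>2"
        by (simp_all add: 2 power_add power2_eq_square assms(3) algebra_simps)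
      then show ?thesis
        using fold_step[OF xdj, of y] fold_step[OF xdj, of "x * y"] mult assms(2) by (simp add: mult.assoc)
    qed
  qed
qed

theorem mainTheorem1:
  fixes x y d :: nat
  assumes "1 \<le> x" and "1 \<le> y" and "4 \<le> x * y"
    and "d = x ^ 2 * y"
    and "\<forall>D\<in>{d, x * d}. \<exists>(b::nat) as.
           coprime b D \<and> is_contfrac_expansion (of_nat b / of_nat D) as \<and>
           (\<forall>a\<in>set as. a \<le> x * y - 1) \<and>
           2 \<le> hd as \<and> hd as \<le> x * y - 2 \<and>
           2 \<le> last as \<and> last as \<le> x * y - 2"
  shows "\<forall>k::nat. 1 \<le> k \<longrightarrow> zaremba (x * y - 1) (d ^ k)"
proof (intro allI impI)
  fix k :: nat
  assume k: "1 \<le> k"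
  have d: "d = x * (x * y)" using assms(4) by (simp add: power2_eq_square)
  have le: "x * y \<le> d" "d \<le> x * d" using assms(1) d by simp_all
  have base: "foldable (x * y) D" if D: "D \<in> {d, x * d}" for D
  proof -
    obtain b as where as: "coprime b D" "is_contfrac_expansion (of_nat b / of_nat D) as"
      "\<forall>a\<in>set as. a \<le> x * y - 1" "2 \<le> hd as" "hd as \<le> x * y - 2"
      "2 \<le> last as" "last as \<le> x * y - 2"
      using assms(5) D by blast
    have large: "x * y \<le> D" using D le le_trans[OF le] by blast
    have cont: "continuant as = D"
      using as(1,2) large assms(3) by (intro expansion_denominator) auto
    have ne: "as \<noteq> []" and ge: "\<forall>a\<in>set as. 1 \<le> a"
      using as(2) by (auto simp: is_contfrac_expansion_def)
    \<comment> \<open>A single partial quotient would be the denominator itself, which is too large for that.\<close>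
    have "length as \<noteq> 1"
    proof
      assume "length as = 1"
      then obtain c where "as = [c]" by (auto simp: length_Suc_conv)
      then show False using cont large as(4,5) by simp
    qed
    then have "2 \<le> length as" using ne by (cases as) (auto simp: Suc_le_eq)
    then show ?thesis unfolding foldable_def using as(3-7) ge cont by auto
  qed
  have "foldable (x * y) (d ^ k)"
    using foldable_powers[OF assms(1,2,4) _ _ k] base by simp
  moreover have "2 \<le> d ^ k"
  proof -
    have "d ^ 1 \<le> d ^ k" using k le assms(3) by (intro power_increasing) auto
    then show ?thesis using le assms(3) by simp
  qed
  ultimately show "zaremba (x * y - 1) (d ^ k)" by (rule foldable_imp_zaremba)
qed

end
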